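(* Let $p^\star=\sum_{\ell=1}^m\pi^\star_\ell\phi(\cdot\mid\mu^\star_\ell)$ satisfy the standing assumptions (A1)–(A3) of the context. Let $[n]=\bigsqcup_{\ell=1}^mS_\ell$ be a partition into nonempty sets and let $\widetilde\mu\in\mathbb R^{dn}$ be given by $\widetilde\mu_i=\mu^\star_\ell$ for $i\in S_\ell$. Let $U$ be a compact neighborhood of $\widetilde\mu$ such that for every $\mu\in U$ and every $i\in S_\ell$, $\mu_i$ is at least as close to $\mu_\ell^\star$ as to any other $\mu_j^\star$, and define $\mathcal L^\dagger_\pi:=\min_{\mu\in U}\mathcal L(\mu,\pi)$. Then there exist a neighborhood $V\subset\operatorname{int}\Delta^{m-1}$ of $\pi^\star$ (interior relative to the simplex) and a constant $C_{\mathrm{floor}}>0$ such that, writing $\mathcal L^\star=0$ for the minimal value of $\mathcal L$, $$\mathcal L_\pi^\dagger-\mathcal L^\star\le C_{\mathrm{floor}}\,\Delta_\pi^2\qquad\text{for all }\pi\in\Delta^{n-1}\text{ with }\widehat\pi\in V.$$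
   Context: $\phi(x\mid\mu)=(2\pi)^{-d/2}e^{-\|x-\mu\|^2/2}$ on $\mathbb R^d$; $\Delta^{k-1}$ is the probability simplex in $\mathbb R^k$. For $\mu=(\mu_1,\dots,\mu_n)\in\mathbb R^{dn}$ and $\pi\in\Delta^{n-1}$, $p_{\mu,\pi}=\sum_{i=1}^n\pi_i\phi(\cdot\mid\mu_i)$ and $\mathcal L(\mu,\pi)=\mathbb E_{X\sim p^\star}[\log(p^\star(X)/p_{\mu,\pi}(X))]$. $\widehat\pi=(\widehat\pi_1,\dots,\widehat\pi_m)$ with $\widehat\pi_\ell=\sum_{i\in S_\ell}\pi_i$, and $\Delta_\pi=\max_{\ell\in[m]}|\widehat\pi_\ell-\pi_\ell^\star|/\pi_\ell^\star$. Standing assumptions on the teacher (weights $\pi^\star$ positive): (A1) $M^\star=\sum_{\ell}\pi^\star_\ell\mu_\ell^\star{\mu_\ell^\star}^{\top}$ has exactly $m$ nonzero eigenvalues, the largest being $\lambda_{\max}$ and the smallest $\lambda_{\min}>0$. (A2) $D_{\max}\ge\|\mu_\ell^\star\|\ge D_{\min}\ge 4\frac{\lambda_{\max}}{\lambda_{\min}}\sqrt{dn}$ for all $\ell$. (A3) With $\pi^\star_{\min}=\min_\ell\pi^\star_\ell$, $\min_{i\ne j}\|\mu_i^\star-\mu_j^\star\|\ge C_0\max\{\sqrt{D_{\max}}(dn)^{1/4},\sqrt{d/\pi^\star_{\min}},\sqrt{\log(D_{\max}dnm/(\lambda_{\min}\pi^\star_{\min}))}\}$ for a sufficiently large absolute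 constant $C_0>0$. *)

theory Defs
  imports "HOL-Probability.Probability" "Jordan_Normal_Form.Char_Poly"
begin

text \<open>
  The constant \<open>C\<^sub>0\<close> of the separation assumption is absolute, so the dimensions have to be
  quantified below it and cannot be types.  Points of \<open>\<real>\<^sup>k\<close> are therefore functions
  \<open>nat \<Rightarrow> real\<close> vanishing from index \<open>k\<close> on, with the topology inherited from the function
  space; this is the carrier and the topology of the library's \<open>Euclidean_space k\<close>.
  Indices run over \<open>{..<k}\<close> instead of \<open>{1..k}\<close>.
\<close>

definition rvecs :: "nat \<Rightarrow> (nat \<Rightarrow> real) set" where
  "rvecs k = {x. \<forall>j\<ge>k. x j = 0}"

text \<open>\<open>\<real>\<^sup>d\<^sup>n\<close>, read as the space of \<open>n\<close>-tuples of points of \<open>\<real>\<^sup>d\<close>.\<close>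

definition configs :: "nat \<Rightarrow> nat \<Rightarrow> (nat \<Rightarrow> nat \<Rightarrow> real) set" where
  "configs d n = {\<mu>. (\<forall>i<n. \<mu> i \<in> rvecs d) \<and> (\<forall>i\<ge>n. \<mu> i = (\<lambda>_. 0))}"

definition edist :: "nat \<Rightarrow> (nat \<Rightarrow> real) \<Rightarrow> (nat \<Rightarrow> real) \<Rightarrow> real" where
  "edist d x y = L2_set (\<lambda>j. x j - y j) {..<d}"

definition prob_simplex :: "nat \<Rightarrow> (nat \<Rightarrow> real) set" where
  "prob_simplex k = {w \<in> rvecs k. (\<forall>i<k. 0 \<le> w i) \<and> (\<Sum>i<k. w i) = 1}"

text \<open>The relative interior: the interior taken in the affine hull of the simplex.\<close>

definition simplex_interior :: "nat \<Rightarrow> (nat \<Rightarrow> real) set" where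
  "simplex_interior k =
     (top_of_set {w \<in> rvecs k. (\<Sum>i<k. w i) = 1}) interior_of (prob_simplex k)"

definition gauss :: "nat \<Rightarrow> (nat \<Rightarrow> real) \<Rightarrow> (nat \<Rightarrow> real) \<Rightarrow> real" where
  "gauss d \<mu> x = (2 * pi) powr (- (real d / 2)) * exp (- (edist d x \<mu>)\<^sup>2 / 2)"

definition mixture :: "nat \<Rightarrow> nat \<Rightarrow> (nat \<Rightarrow> nat \<Rightarrow> real) \<Rightarrow> (nat \<Rightarrow> real) \<Rightarrow> (nat \<Rightarrow> real) \<Rightarrow> real" where
  "mixture d k \<mu> w x = (\<Sum>i<k. w i * gauss d (\<mu> i) x)"

text \<open>
  The points of the product measure space are \<open>undefined\<close>, not zero, outside \<open>{..<d}\<close>; this is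
  immaterial, because the densities only read the coordinates below \<open>d\<close>.
\<close>

definition mixture_measure ::
  "nat \<Rightarrow> nat \<Rightarrow> (nat \<Rightarrow> nat \<Rightarrow> real) \<Rightarrow> (nat \<Rightarrow> real) \<Rightarrow> (nat \<Rightarrow> real) measure" where
  "mixture_measure d k \<mu> w =
     density (\<Pi>\<^sub>M j\<in>{..<d}. lborel) (\<lambda>x. ennreal (mixture d k \<mu> w x))"

text \<open>\<open>\<L>(\<mu>, \<pi>)\<close>; the teacher has \<open>m\<close> components \<open>\<mu>s\<close> with weights \<open>ws\<close>, the student \<open>n\<close>
  components \<open>\<mu>\<close> with weights \<open>w\<close>.\<close>

definition loss ::
  "nat \<Rightarrow> nat \<Rightarrow> nat \<Rightarrow> (nat \<Rightarrow> nat \<Rightarrow> real) \<Rightarrow> (nat \<Rightarrow> real)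
    \<Rightarrow> (nat \<Rightarrow> nat \<Rightarrow> real) \<Rightarrow> (nat \<Rightarrow> real) \<Rightarrow> real" where
  "loss d n m \<mu>s ws \<mu> w =
     (\<integral>x. ln (mixture d m \<mu>s ws x / mixture d n \<mu> w x) \<partial>mixture_measure d m \<mu>s ws)"

text \<open>Both minima are rendered by \<open>LEAST\<close>, which is meaningful only if they are attained.\<close>

definition min_loss ::
  "nat \<Rightarrow> nat \<Rightarrow> nat \<Rightarrow> (nat \<Rightarrow> nat \<Rightarrow> real) \<Rightarrow> (nat \<Rightarrow> real) \<Rightarrow> real" where
  "min_loss d n m \<mu>s ws =
     (LEAST v. v \<in> (\<lambda>(\<mu>, w). loss d n m \<mu>s ws \<mu> w) ` (configs d n \<times> prob_simplex n))"

definition loss_dagger ::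
  "nat \<Rightarrow> nat \<Rightarrow> nat \<Rightarrow> (nat \<Rightarrow> nat \<Rightarrow> real) \<Rightarrow> (nat \<Rightarrow> real)
    \<Rightarrow> (nat \<Rightarrow> nat \<Rightarrow> real) set \<Rightarrow> (nat \<Rightarrow> real) \<Rightarrow> real" where
  "loss_dagger d n m \<mu>s ws U w = (LEAST v. v \<in> (\<lambda>\<mu>. loss d n m \<mu>s ws \<mu> w) ` U)"

definition group_weights :: "nat \<Rightarrow> (nat \<Rightarrow> nat set) \<Rightarrow> (nat \<Rightarrow> real) \<Rightarrow> nat \<Rightarrow> real" where
  "group_weights m S w = (\<lambda>l. if l < m then \<Sum>i\<in>S l. w i else 0)"

definition weight_dev ::
  "nat \<Rightarrow> (nat \<Rightarrow> real) \<Rightarrow> (nat \<Rightarrow> nat set) \<Rightarrow> (nat \<Rightarrow> real) \<Rightarrow> real" where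
  "weight_dev m ws S w = Max ((\<lambda>l. \<bar>group_weights m S w l - ws l\<bar> / ws l) ` {..<m})"

definition moment_matrix ::
  "nat \<Rightarrow> nat \<Rightarrow> (nat \<Rightarrow> nat \<Rightarrow> real) \<Rightarrow> (nat \<Rightarrow> real) \<Rightarrow> real Matrix.mat" where
  "moment_matrix d m \<mu>s ws = Matrix.mat d d (\<lambda>(i, j). \<Sum>l<m. ws l * \<mu>s l i * \<mu>s l j)"

definition nonzero_eigenvalues :: "real Matrix.mat \<Rightarrow> real set" where
  "nonzero_eigenvalues A = {x. eigenvalue A x \<and> x \<noteq> 0}"

text \<open>Eigenvalues are counted with multiplicity.\<close>

definition assumption_A1 ::
  "nat \<Rightarrow> nat \<Rightarrow> (nat \<Rightarrow> nat \<Rightarrow> real) \<Rightarrow> (nat \<Rightarrow> real) \<Rightarrow> real \<Rightarrow> real \<Rightarrow> bool" where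
  "assumption_A1 d m \<mu>s ws lmax lmin \<longleftrightarrow>
     (let A = moment_matrix d m \<mu>s ws; E = nonzero_eigenvalues A in
        (\<Sum>x\<in>E. order x (char_poly A)) = m \<and> lmax = Max E \<and> lmin = Min E \<and> lmin > 0)"

definition assumption_A2 ::
  "nat \<Rightarrow> nat \<Rightarrow> nat \<Rightarrow> (nat \<Rightarrow> nat \<Rightarrow> real) \<Rightarrow> real \<Rightarrow> real \<Rightarrow> real \<Rightarrow> real \<Rightarrow> bool" where
  "assumption_A2 d n m \<mu>s lmax lmin Dmax Dmin \<longleftrightarrow>
     (\<forall>l<m. Dmax \<ge> L2_set (\<mu>s l) {..<d} \<and> L2_set (\<mu>s l) {..<d} \<ge> Dmin)
     \<and> Dmin \<ge> 4 * (lmax / lmin) * sqrt (real (d * n))"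

text \<open>
  If the argument of the logarithm is below 1, \<open>sqrt\<close> returns a nonpositive number and that entry
  of the maximum imposes nothing.
\<close>

definition assumption_A3 ::
  "real \<Rightarrow> nat \<Rightarrow> nat \<Rightarrow> nat \<Rightarrow> (nat \<Rightarrow> nat \<Rightarrow> real) \<Rightarrow> (nat \<Rightarrow> real) \<Rightarrow> real \<Rightarrow> real \<Rightarrow> bool" where
  "assumption_A3 C0 d n m \<mu>s ws lmin Dmax \<longleftrightarrow>
     (let wmin = Min (ws ` {..<m}) in
        \<forall>i<m. \<forall>j<m. i \<noteq> j \<longrightarrow>
          edist d (\<mu>s i) (\<mu>s j) \<ge>
            C0 * Max {sqrt Dmax * real (d * n) powr (1 / 4),
                      sqrt (real d / wmin),
                      sqrt (ln (Dmax * real d * real n * real m / (lmin * wmin)))})"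

definition teacher ::
  "real \<Rightarrow> nat \<Rightarrow> nat \<Rightarrow> nat \<Rightarrow> (nat \<Rightarrow> nat \<Rightarrow> real) \<Rightarrow> (nat \<Rightarrow> real)
    \<Rightarrow> real \<Rightarrow> real \<Rightarrow> real \<Rightarrow> real \<Rightarrow> bool" where
  "teacher C0 d n m \<mu>s ws lmax lmin Dmax Dmin \<longleftrightarrow>
     \<mu>s \<in> configs d m \<and> ws \<in> prob_simplex m \<and> (\<forall>l<m. ws l > 0)
     \<and> assumption_A1 d m \<mu>s ws lmax lmin
     \<and> assumption_A2 d n m \<mu>s lmax lmin Dmax Dmin
     \<and> assumption_A3 C0 d n m \<mu>s ws lmin Dmax"

definition index_partition :: "nat \<Rightarrow> nat \<Rightarrow> (nat \<Rightarrow> nat set) \<Rightarrow> bool" where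
  "index_partition n m S \<longleftrightarrow>
     (\<Union>l<m. S l) = {..<n} \<and> disjoint_family_on S {..<m} \<and> (\<forall>l<m. S l \<noteq> {})"

end

theory Submission
  imports Defs
begin

text \<open>
  The configuration \<open>\<mu>t\<close> lies in \<open>U\<close>, and there the student's density is the teacher's
  mixture with weights \<open>group_weights m S w\<close>.  Its relative deviation \<open>e\<close> from the teacher's
  density is bounded by \<open>weight_dev\<close> and has mean zero, so the bound
  \<open>- ln (1 + e) \<le> - e + 2 * e\<^sup>2\<close> integrates to the quadratic bound.  The minimum over \<open>U\<close> is attained
  because the loss is continuous on \<open>U\<close> by dominated convergence.
\<close>

section \<open>Gaussian densities: pointwise bounds, product form, moments\<close>

abbreviation coords :: "nat \<Rightarrow> (nat \<Rightarrow> real) measure" where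
  "coords d \<equiv> \<Pi>\<^sub>M j\<in>{..<d}. lborel"

lemma edist_sq: "(edist d x y)\<^sup>2 = (\<Sum>j<d. (x j - y j)\<^sup>2)"
  unfolding edist_def L2_set_def by (simp add: sum_nonneg)

lemma gauss_pos: "gauss d \<mu> x > 0"
  unfolding gauss_def by simp

lemma gauss_le: "gauss d \<mu> x \<le> (2 * pi) powr (- (real d / 2))"
  unfolding gauss_def by (simp add: mult_left_le)

text \<open>Expanding \<open>(a + b)^2 >= 0\<close> gives \<open>(a - b)^2 / 2 <= a^2 + b^2\<close>
  in each coordinate. This separates \<open>x\<close> from the mean, so the bound is uniform over
  bounded sets of means.\<close>

lemma gauss_ge:
  "gauss d \<mu> x \<ge> (2 * pi) powr (- (real d / 2)) * exp (- ((\<Sum>j<d. (x j)\<^sup>2) + (\<Sum>j<d. (\<mu> j)\<^sup>2)))"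
proof -
  have "(a - b)\<^sup>2 / 2 \<le> a\<^sup>2 + b\<^sup>2" for a b :: real
    using zero_le_power2[of "a + b"] by (simp add: power2_eq_square algebra_simps)
  then have "(\<Sum>j<d. (x j - \<mu> j)\<^sup>2 / 2) \<le> (\<Sum>j<d. (x j)\<^sup>2 + (\<mu> j)\<^sup>2)"
    by (intro sum_mono) auto
  then show ?thesis
    unfolding gauss_def edist_sq by (simp add: sum.distrib sum_divide_distrib)
qed

text \<open>The product form reduces measurability and integration over \<open>coords d\<close> to
  facts about the one-dimensional normal density.\<close>

lemma gauss_eq_prod: "gauss d \<mu> x = (\<Prod>j<d. normal_density (\<mu> j) 1 (x j))"
proof -
  have "(2 * pi) powr (- (real d / 2)) = (1 / sqrt (2 * pi)) ^ d"
  proof -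
    have "(1 / sqrt (2 * pi)) ^ d = (((2 * pi) powr (- 1 / 2)) powr real d)"
      by (simp add: powr_realpow powr_minus_divide powr_half_sqrt)
    then show ?thesis by (simp add: powr_powr)
  qed
  then show ?thesis
    unfolding gauss_def edist_sq normal_density_def
    by (simp add: prod_dividef exp_sum sum_divide_distrib power_one_over flip: sum_negf)
qed

lemma borel_measurable_gauss [measurable]: "gauss d \<mu> \<in> borel_measurable (coords d)"
  unfolding gauss_eq_prod[abs_def] by measurable

lemma borel_measurable_mixture [measurable]: "mixture d k \<mu> w \<in> borel_measurable (coords d)"
  unfolding mixture_def[abs_def] by measurable

interpretation lborel_product: product_sigma_finite "\<lambda>_::nat. lborel :: real measure"
  by standard

lemma integrable_gauss: "integrable (coords d) (gauss d \<mu>)"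
  unfolding gauss_eq_prod[abs_def] by (intro lborel_product.product_integrable_prod) auto

lemma integral_gauss: "(\<integral>x. gauss d \<mu> x \<partial>coords d) = 1"
  unfolding gauss_eq_prod by (subst lborel_product.product_integral_prod) auto

lemma integrable_gauss_coord_sq:
  assumes "j < d"
  shows "integrable (coords d) (\<lambda>x. gauss d \<mu> x * (x j)\<^sup>2)"
proof -
  let ?N = "\<lambda>i. normal_density (\<mu> i) 1"
  \<comment> \<open>The factor \<open>y^2\<close> is placed in coordinate \<open>j\<close> alone,
    which keeps the integrand a product over the coordinates.\<close>
  let ?f = "\<lambda>i y. ?N i y * (if i = j then y\<^sup>2 else 1)"
  have "integrable lborel (?f i)" for i
  proof -
    \<comment> \<open>Expanding about the mean, \<open>y^2 = (y - a)^2 + 2 * a * y - a^2\<close>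
      with \<open>a = \<mu> i\<close>, leaves only standard normal moments.\<close>
    have "?N i y * y\<^sup>2 = ?N i y * (y - \<mu> i)^2 + 2 * \<mu> i * (?N i y * y) - (\<mu> i)\<^sup>2 * ?N i y" for y
      by (simp add: power2_eq_square algebra_simps)
    moreover have "integrable lborel
        (\<lambda>y. ?N i y * (y - \<mu> i)^2 + 2 * \<mu> i * (?N i y * y) - (\<mu> i)\<^sup>2 * ?N i y)"
      by (intro Bochner_Integration.integrable_add Bochner_Integration.integrable_diff
          integrable_mult_right integrable_normal_moment integrable_normal_moment_nz_1
          integrable_normal_density) auto
    ultimately show ?thesis
      by (cases "i = j") (auto intro: integrable_normal_density)
  qed
  then have "integrable (coords d) (\<lambda>x. \<Prod>i<d. ?f i (x i))"
    by (intro lborel_product.product_integrable_prod) auto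
  moreover have "(\<Prod>i<d. ?f i (x i)) = gauss d \<mu> x * (x j)\<^sup>2" for x
    using assms by (simp add: gauss_eq_prod prod.distrib)
  ultimately show ?thesis by simp
qed

section \<open>Mixtures: integrals, positivity, and growth of the logarithm\<close>

lemma integrable_mixture: "integrable (coords d) (mixture d k \<mu> w)"
  unfolding mixture_def[abs_def]
  by (intro Bochner_Integration.integrable_sum integrable_mult_right integrable_gauss)

lemma integral_mixture: "(\<integral>x. mixture d k \<mu> w x \<partial>coords d) = (\<Sum>i<k. w i)"
  unfolding mixture_def
  by (simp add: Bochner_Integration.integral_sum integrable_gauss integral_gauss)

text \<open>Log-densities of mixtures grow at most quadratically in \<open>x\<close>, so this
  supplies the dominating function for the loss integrand.\<close>

lemma integrable_mixture_sq_norm: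
  "integrable (coords d) (\<lambda>x. mixture d k \<mu> w x * (\<Sum>j<d. (x j)\<^sup>2))"
  unfolding mixture_def sum_distrib_right sum_distrib_left
  using integrable_gauss_coord_sq
  by (intro Bochner_Integration.integrable_sum) (auto simp: mult.assoc)

text \<open>A convex combination inherits bounds common to all its terms. The lower bound depends on
  the means only through \<open>R\<close>.\<close>

lemma mixture_bounds:
  assumes w: "w \<in> prob_simplex k" and R: "\<And>i. i < k \<Longrightarrow> (\<Sum>j<d. (\<mu> i j)\<^sup>2) \<le> R"
  defines "c \<equiv> (2 * pi) powr (- (real d / 2))"
  shows "c * exp (- ((\<Sum>j<d. (x j)\<^sup>2) + R)) \<le> mixture d k \<mu> w x" "mixture d k \<mu> w x \<le> c"
proof -
  have w0: "\<And>i. i < k \<Longrightarrow> w i \<ge> 0" and w1: "(\<Sum>i<k. w i) = 1"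
    using w by (auto simp: prob_simplex_def)
  have c: "c > 0" by (simp add: c_def)
  have "c * exp (- ((\<Sum>j<d. (x j)\<^sup>2) + R)) \<le> gauss d (\<mu> i) x" if "i < k" for i
    using R[OF that] c by (intro order_trans[OF _ gauss_ge]) (simp add: c_def)
  then have "(\<Sum>i<k. w i * (c * exp (- ((\<Sum>j<d. (x j)\<^sup>2) + R)))) \<le> mixture d k \<mu> w x"
    unfolding mixture_def using w0 by (intro sum_mono mult_left_mono) auto
  then show "c * exp (- ((\<Sum>j<d. (x j)\<^sup>2) + R)) \<le> mixture d k \<mu> w x"
    by (simp add: w1 flip: sum_distrib_right)
  have "mixture d k \<mu> w x \<le> (\<Sum>i<k. w i * c)"
    unfolding mixture_def c_def using w0 by (intro sum_mono mult_left_mono gauss_le) auto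
  then show "mixture d k \<mu> w x \<le> c" by (simp add: w1 flip: sum_distrib_right)
qed

lemma mixture_pos:
  assumes "w \<in> prob_simplex k"
  shows "mixture d k \<mu> w x > 0"
proof -
  \<comment> \<open>The total of all squared norms serves as the common bound
    \<open>R\<close>.\<close>
  have "(\<Sum>j<d. (\<mu> i j)\<^sup>2) \<le> (\<Sum>i<k. \<Sum>j<d. (\<mu> i j)\<^sup>2)" if "i < k" for i
    using that by (intro member_le_sum) (auto intro: sum_nonneg)
  from mixture_bounds(1)[OF assms this] show ?thesis
    by (rule less_le_trans[rotated]) simp_all
qed

lemma abs_ln_mixture_le:
  assumes "w \<in> prob_simplex k" and "\<And>i. i < k \<Longrightarrow> (\<Sum>j<d. (\<mu> i j)\<^sup>2) \<le> R"
  shows "\<bar>ln (mixture d k \<mu> w x) - ln ((2 * pi) powr (- (real d / 2)))\<bar> \<le> (\<Sum>j<d. (x j)\<^sup>2) + R"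
proof -
  let ?c = "(2 * pi) powr (- (real d / 2))"
  have c: "?c > 0" by simp
  have "ln (?c * exp (- ((\<Sum>j<d. (x j)\<^sup>2) + R))) \<le> ln (mixture d k \<mu> w x)"
    using mixture_bounds(1)[OF assms] mixture_pos[OF assms(1)] c by (subst ln_le_cancel_iff) auto
  moreover have "ln (mixture d k \<mu> w x) \<le> ln ?c"
    using mixture_bounds(2)[OF assms] mixture_pos[OF assms(1)] c by (subst ln_le_cancel_iff) auto
  moreover have "ln (?c * exp (- ((\<Sum>j<d. (x j)\<^sup>2) + R))) = ln ?c - ((\<Sum>j<d. (x j)\<^sup>2) + R)"
    using c by (subst ln_mult) auto
  \<comment> \<open>Together the two bounds on the logarithm also force the right-hand side of the
    goal to be nonnegative, as the upper estimate requires.\<close>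
  ultimately show ?thesis by linarith
qed

section \<open>The loss: Gibbs' inequality and a quadratic upper bound\<close>

lemma loss_eq:
  assumes "ws \<in> prob_simplex m"
  shows "loss d n m \<mu>s ws \<mu> w =
    (\<integral>x. mixture d m \<mu>s ws x * ln (mixture d m \<mu>s ws x / mixture d n \<mu> w x) \<partial>coords d)"
  unfolding loss_def mixture_measure_def
  by (subst integral_density) (auto intro: less_imp_le[OF mixture_pos[OF assms]])

text \<open>Gibbs' inequality: \<open>ln t <= t - 1\<close> at \<open>t = q / p\<close> gives
  \<open>p - q <= p * ln (p / q)\<close> pointwise, and \<open>p - q\<close> integrates to 0 because
  both densities have mass 1.\<close>

lemma loss_nonneg:
  assumes ws: "ws \<in> prob_simplex m" and w: "w \<in> prob_simplex n"
  shows "loss d n m \<mu>s ws \<mu> w \<ge> 0"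
proof -
  let ?p = "mixture d m \<mu>s ws" and ?q = "mixture d n \<mu> w"
  let ?f = "\<lambda>x. ?p x * ln (?p x / ?q x)"
  have "integral\<^sup>L (coords d) ?f \<ge> 0"
  \<comment> \<open>The integral of a non-integrable function is 0 by convention, so the other case
    is immediate.\<close>
  proof (cases "integrable (coords d) ?f")
    case True
    have "?p x - ?q x \<le> ?f x" for x
    proof -
      note pos = mixture_pos[OF ws, of d \<mu>s x] mixture_pos[OF w, of d \<mu> x]
      have "ln (?q x / ?p x) \<le> ?q x / ?p x - 1"
        using pos by (intro ln_le_minus_one) simp
      then have "1 - ?q x / ?p x \<le> ln (?p x / ?q x)"
        using pos by (simp add: ln_div)
      then have "?p x * (1 - ?q x / ?p x) \<le> ?f x"
        using pos by (intro mult_left_mono) auto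
      then show ?thesis using pos by (simp add: right_diff_distrib)
    qed
    then have "(\<integral>x. ?p x - ?q x \<partial>coords d) \<le> integral\<^sup>L (coords d) ?f"
      using True by (intro integral_mono Bochner_Integration.integrable_diff integrable_mixture)
    then show ?thesis
      using ws w by (simp add: integrable_mixture integral_mixture prob_simplex_def)
  qed (simp add: not_integrable_integral_eq)
  then show ?thesis by (simp add: loss_eq[OF ws])
qed

text \<open>With \<open>q = p * (1 + e)\<close>, the first-order term \<open>- p * e\<close> of
  \<open>p * ln (p / q)\<close> equals \<open>p - q\<close> and integrates to 0, so only the
  second-order term survives. The condition \<open>\<delta> <= 1/2\<close> keeps \<open>e\<close> in
  the range of the logarithm estimate.\<close>

lemma loss_le_of_rel_dev:
  assumes ws: "ws \<in> prob_simplex m" and w: "w \<in> prob_simplex n"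
    and dev: "\<And>x. \<bar>mixture d n \<mu> w x - mixture d m \<mu>s ws x\<bar> \<le> \<delta> * mixture d m \<mu>s ws x"
    and "0 \<le> \<delta>" "\<delta> \<le> 1/2"
  shows "loss d n m \<mu>s ws \<mu> w \<le> 2 * \<delta>\<^sup>2"
proof -
  let ?p = "mixture d m \<mu>s ws" and ?q = "mixture d n \<mu> w"
  let ?f = "\<lambda>x. ?p x * ln (?p x / ?q x)"
  have "integral\<^sup>L (coords d) ?f \<le> 2 * \<delta>\<^sup>2"
  proof (cases "integrable (coords d) ?f")
    case True
    have "?f x \<le> ?p x - ?q x + 2 * \<delta>\<^sup>2 * ?p x" for x
    proof -
      note pos = mixture_pos[OF ws, of d \<mu>s x] mixture_pos[OF w, of d \<mu> x]
      define e where "e = (?q x - ?p x) / ?p x"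
      have q: "?q x = ?p x * (1 + e)" using pos by (simp add: e_def field_simps)
      have e: "\<bar>e\<bar> \<le> \<delta>" using dev[of x] pos by (simp add: e_def divide_simps)
      have "\<bar>ln (1 + e) - e\<bar> \<le> 2 * e\<^sup>2"
        using e assms(5) by (intro abs_ln_one_plus_x_minus_x_bound) linarith
      moreover have "e\<^sup>2 \<le> \<delta>\<^sup>2" using e assms(4) by (simp flip: abs_le_square_iff)
      ultimately have "- ln (1 + e) \<le> - e + 2 * \<delta>\<^sup>2" by linarith
      moreover have "ln (?p x / ?q x) = - ln (1 + e)"
        using pos e assms(5) by (simp add: q ln_div ln_mult)
      ultimately have "?f x \<le> ?p x * (- e + 2 * \<delta>\<^sup>2)"
        using pos by (metis less_imp_le mult_left_mono)
      then show ?thesis by (simp add: q algebra_simps)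
    qed
    then have "integral\<^sup>L (coords d) ?f \<le> (\<integral>x. ?p x - ?q x + 2 * \<delta>\<^sup>2 * ?p x \<partial>coords d)"
      using True by (intro integral_mono Bochner_Integration.integrable_add
          Bochner_Integration.integrable_diff integrable_mult_right integrable_mixture)
    then show ?thesis
      using ws w by (simp add: integrable_mixture integral_mixture prob_simplex_def)
  qed (simp add: not_integrable_integral_eq)
  then show ?thesis by (simp add: loss_eq[OF ws])
qed

section \<open>Continuity of the loss in the means and attainment of its minimum\<close>

lemma continuous_on_config_entry: "continuous_on U (\<lambda>\<mu> :: nat \<Rightarrow> nat \<Rightarrow> real. \<mu> i j)"
  using continuous_on_compose2[OF continuous_on_product_coordinates continuous_on_product_coordinates]
  by (rule continuous_on_subset[of UNIV]) auto

text \<open>The sum of all squared entries is continuous in the product topology, hence bounded on a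
  compact set, and it dominates each squared norm.\<close>

lemma compact_configs_bounded:
  assumes "compact (U :: (nat \<Rightarrow> nat \<Rightarrow> real) set)"
  obtains R where "\<And>\<mu> i. \<mu> \<in> U \<Longrightarrow> i < n \<Longrightarrow> (\<Sum>j<d. (\<mu> i j)\<^sup>2) \<le> R"
proof -
  have "compact ((\<lambda>\<mu>. \<Sum>i<n. \<Sum>j<d. (\<mu> i j)\<^sup>2) ` U)"
    using assms
    by (intro compact_continuous_image continuous_on_sum continuous_on_power continuous_on_config_entry)
  from compact_imp_bounded[OF this]
  obtain R where "\<forall>\<mu>\<in>U. \<bar>\<Sum>i<n. \<Sum>j<d. (\<mu> i j)\<^sup>2\<bar> \<le> R"
    by (auto simp: bounded_iff)
  then have R: "(\<Sum>i<n. \<Sum>j<d. (\<mu> i j)\<^sup>2) \<le> R" if "\<mu> \<in> U" for \<mu>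
    using that abs_le_D1 by blast
  have "(\<Sum>j<d. (\<mu> i j)\<^sup>2) \<le> R" if "\<mu> \<in> U" "i < n" for \<mu> i
  proof -
    have "(\<Sum>j<d. (\<mu> i j)\<^sup>2) \<le> (\<Sum>i<n. \<Sum>j<d. (\<mu> i j)\<^sup>2)"
      using \<open>i < n\<close> by (intro member_le_sum) (auto intro: sum_nonneg)
    with R[OF \<open>\<mu> \<in> U\<close>] show ?thesis by linarith
  qed
  then show ?thesis using that by blast
qed

lemma continuous_on_mixture: "continuous_on U (\<lambda>\<mu>. mixture d n \<mu> w x)"
  unfolding mixture_def gauss_def edist_sq
  by (intro continuous_intros continuous_on_config_entry) auto

text \<open>Dominated convergence along sequences, which suffice because the configuration space is
  a countable product of real lines. Compactness of \<open>U\<close> makes the dominating function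
  uniform in \<mu>.\<close>

lemma continuous_on_loss:
  assumes U: "compact U" and ws: "ws \<in> prob_simplex m" and w: "w \<in> prob_simplex n"
  shows "continuous_on U (\<lambda>\<mu>. loss d n m \<mu>s ws \<mu> w)"
proof (rule continuous_on_sequentiallyI)
  fix u a assume u: "\<forall>k. u k \<in> U" and a: "a \<in> U" and lim: "u \<longlonglongrightarrow> a"
  let ?p = "mixture d m \<mu>s ws" and ?q = "\<lambda>\<mu>. mixture d n \<mu> w"
  obtain R where R: "\<And>\<mu> i. \<mu> \<in> U \<Longrightarrow> i < n \<Longrightarrow> (\<Sum>j<d. (\<mu> i j)\<^sup>2) \<le> R"
    using compact_configs_bounded[OF U] by blast
  \<comment> \<open>The singleton \<open>{\<mu>s}\<close> is compact, so the same lemma bounds the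
    teacher's means.\<close>
  obtain R' where R': "\<And>i. i < m \<Longrightarrow> (\<Sum>j<d. (\<mu>s i j)\<^sup>2) \<le> R'"
    using compact_configs_bounded[of "{\<mu>s}" m d] by (metis compact_sing singletonI)
  note pos = mixture_pos[OF ws] mixture_pos[OF w]
  have bound: "norm (?p x * ln (?p x / ?q (u k) x)) \<le>
      2 * (?p x * (\<Sum>j<d. (x j)\<^sup>2)) + (R + R') * ?p x" for k x
  proof -
    \<comment> \<open>Both log-densities are compared with the same normalizing constant, which
      cancels in their difference, so the two bounds add.\<close>
    have "\<bar>ln (?p x / ?q (u k) x)\<bar> \<le> 2 * (\<Sum>j<d. (x j)\<^sup>2) + (R + R')"
      using abs_ln_mixture_le[OF w, of "u k" d R x] abs_ln_mixture_le[OF ws, of \<mu>s d R' x] R R' u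
        pos(1)[of d \<mu>s x] pos(2)[of d "u k" x]
      by (simp add: ln_div)
    then have "?p x * \<bar>ln (?p x / ?q (u k) x)\<bar> \<le> ?p x * (2 * (\<Sum>j<d. (x j)\<^sup>2) + (R + R'))"
      using less_imp_le[OF pos(1)] by (rule mult_left_mono)
    then show ?thesis
      using pos(1)[of d \<mu>s x] by (simp add: abs_mult algebra_simps)
  qed
  have ptw: "(\<lambda>k. ?p x * ln (?p x / ?q (u k) x)) \<longlonglongrightarrow> ?p x * ln (?p x / ?q a x)" for x
  proof -
    have "(\<lambda>k. ?q (u k) x) \<longlonglongrightarrow> ?q a x"
      using continuous_on_mixture[of U d n w x] u a lim
      by (auto simp: continuous_on_sequentially comp_def)
    then show ?thesis
      using pos(1)[of d \<mu>s x] pos(2)[of d a x] by (intro tendsto_intros) auto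
  qed
  have "(\<lambda>k. \<integral>x. ?p x * ln (?p x / ?q (u k) x) \<partial>coords d) \<longlonglongrightarrow>
      (\<integral>x. ?p x * ln (?p x / ?q a x) \<partial>coords d)"
  proof (rule integral_dominated_convergence)
    show "integrable (coords d) (\<lambda>x. 2 * (?p x * (\<Sum>j<d. (x j)\<^sup>2)) + (R + R') * ?p x)"
      by (intro Bochner_Integration.integrable_add integrable_mult_right integrable_mixture
          integrable_mixture_sq_norm)
  qed (use bound ptw in auto)
  then show "(\<lambda>k. loss d n m \<mu>s ws (u k) w) \<longlonglongrightarrow> loss d n m \<mu>s ws a w"
    by (simp add: loss_eq[OF ws])
qed

text \<open>A continuous function attains its infimum on a compact set, so the \<open>LEAST\<close>
  in \<open>loss_dagger\<close> denotes an actual minimum.\<close>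

lemma loss_dagger_le:
  assumes "compact U" "ws \<in> prob_simplex m" "w \<in> prob_simplex n" "\<mu> \<in> U"
  shows "loss_dagger d n m \<mu>s ws U w \<le> loss d n m \<mu>s ws \<mu> w"
proof -
  obtain a where a: "a \<in> U" "\<And>\<nu>. \<nu> \<in> U \<Longrightarrow> loss d n m \<mu>s ws a w \<le> loss d n m \<mu>s ws \<nu> w"
    using continuous_attains_inf[OF assms(1) _ continuous_on_loss[OF assms(1-3)]] assms(4) by blast
  then have "loss_dagger d n m \<mu>s ws U w = loss d n m \<mu>s ws a w"
    unfolding loss_dagger_def by (intro Least_equality) auto
  then show ?thesis using a(2)[OF assms(4)] by simp
qed

section \<open>Merging student components by group; the global minimum\<close>

lemma index_partition_sum:
  fixes f :: "nat \<Rightarrow> 'a :: comm_monoid_add"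
  assumes "index_partition n m S"
  shows "(\<Sum>i<n. f i) = (\<Sum>l<m. \<Sum>i\<in>S l. f i)"
proof -
  have un: "(\<Union>l<m. S l) = {..<n}" and disj: "disjoint_family_on S {..<m}"
    using assms by (auto simp: index_partition_def)
  have "finite (S l)" if "l < m" for l
    using un that by (intro finite_subset[of "S l" "{..<n}"]) auto
  then show ?thesis
    unfolding un[symmetric] using disj
    by (intro sum.UNION_disjoint) (auto simp: disjoint_family_on_def)
qed

text \<open>Components with a common mean add up to one component carrying their total
  weight.\<close>

lemma mixture_grouped:
  assumes "index_partition n m S" and "\<forall>l<m. \<forall>i\<in>S l. \<mu> i = \<mu>s l"
  shows "mixture d n \<mu> w x = mixture d m \<mu>s (group_weights m S w) x"
  unfolding mixture_def index_partition_sum[OF assms(1)] using assms(2)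
  by (auto simp: group_weights_def sum_distrib_right intro!: sum.cong)

text \<open>Each teacher weight is spread evenly over its group, which is finite and
  nonempty.\<close>

lemma group_weights_surj:
  assumes S: "index_partition n m S" and ws: "ws \<in> prob_simplex m"
  obtains w where "w \<in> prob_simplex n" "group_weights m S w = ws"
proof -
  \<comment> \<open>By disjointness at most one term of the sum is nonzero; for
    \<open>i >= n\<close> there is none, as membership in \<open>rvecs n\<close> demands.\<close>
  define w where "w i = (\<Sum>l<m. if i \<in> S l then ws l / card (S l) else 0)" for i
  have un: "(\<Union>l<m. S l) = {..<n}" and disj: "disjoint_family_on S {..<m}"
    and ne: "\<And>l. l < m \<Longrightarrow> S l \<noteq> {}"
    using S by (auto simp: index_partition_def)
  have fin: "finite (S l)" if "l < m" for l
    using un that by (intro finite_subset[of "S l" "{..<n}"]) auto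
  have w_eq: "w i = ws l / card (S l)" if "i \<in> S l" "l < m" for i l
  proof -
    have "i \<in> S l' \<longleftrightarrow> l' = l" if "l' < m" for l'
      using disjoint_family_onD[OF disj, of l' l] that \<open>i \<in> S l\<close> \<open>l < m\<close> by blast
    then have "w i = (\<Sum>l'<m. if l' = l then ws l' / card (S l') else 0)"
      unfolding w_def by (intro sum.cong) auto
    then show ?thesis using \<open>l < m\<close> by simp
  qed
  have group: "(\<Sum>i\<in>S l. w i) = ws l" if "l < m" for l
    using w_eq[OF _ that] fin[OF that] ne[OF that] by simp
  have "w \<in> prob_simplex n"
    unfolding prob_simplex_def rvecs_def
  proof (intro CollectI conjI allI impI)
    fix i assume "n \<le> i"
    then have "i \<notin> S l" if "l < m" for l using un that \<open>n \<le> i\<close> by (metis UN_I lessThan_iff not_le)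
    then show "w i = 0" unfolding w_def by simp
  next
    fix i assume "i < n"
    show "0 \<le> w i" unfolding w_def using ws by (auto simp: prob_simplex_def intro!: sum_nonneg)
  next
    show "(\<Sum>i<n. w i) = 1"
      using ws group by (simp add: index_partition_sum[OF S] prob_simplex_def)
  qed
  moreover have "group_weights m S w = ws"
    using ws group by (auto simp: group_weights_def prob_simplex_def rvecs_def)
  ultimately show ?thesis using that by blast
qed

text \<open>The value 0 is a lower bound by \<open>loss_nonneg\<close>. It is attained at \<mu> once
  the group totals equal \<open>ws\<close>, since the student's density is then the
  teacher's.\<close>

lemma min_loss_eq_0:
  assumes S: "index_partition n m S" and ws: "ws \<in> prob_simplex m"
    and \<mu>: "\<mu> \<in> configs d n" "\<forall>l<m. \<forall>i\<in>S l. \<mu> i = \<mu>s l"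
  shows "min_loss d n m \<mu>s ws = 0"
proof -
  obtain w where w: "w \<in> prob_simplex n" "group_weights m S w = ws"
    using group_weights_surj[OF S ws] by blast
  have "loss d n m \<mu>s ws \<mu> w = 0"
    unfolding loss_eq[OF ws] mixture_grouped[OF S \<mu>(2)] w(2)
    by (simp add: mixture_pos[OF ws, THEN less_imp_neq, symmetric])
  then show ?thesis
    unfolding min_loss_def
  proof (intro Least_equality)
    assume "loss d n m \<mu>s ws \<mu> w = 0"
    then show "0 \<in> (\<lambda>(\<mu>, w). loss d n m \<mu>s ws \<mu> w) ` (configs d n \<times> prob_simplex n)"
      using \<mu>(1) w(1) by (intro image_eqI[of _ _ "(\<mu>, w)"]) auto
  next
    fix v assume "v \<in> (\<lambda>(\<mu>, w). loss d n m \<mu>s ws \<mu> w) ` (configs d n \<times> prob_simplex n)"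
    then show "0 \<le> v" using loss_nonneg[OF ws] by auto
  qed
qed

section \<open>Neighborhoods of the teacher's weights in the simplex\<close>

lemma open_weight_nbhd:
  "open {v :: nat \<Rightarrow> real. \<forall>l<m. \<bar>v l - ws l\<bar> < ws l / 2}"
proof -
  have "open (\<Inter>l<m. {v :: nat \<Rightarrow> real. \<bar>v l - ws l\<bar> < ws l / 2})"
    by (intro open_INT ballI open_Collect_less continuous_intros) auto
  moreover have "(\<Inter>l<m. {v :: nat \<Rightarrow> real. \<bar>v l - ws l\<bar> < ws l / 2}) =
      {v. \<forall>l<m. \<bar>v l - ws l\<bar> < ws l / 2}" by auto
  ultimately show ?thesis by simp
qed

text \<open>On the affine hull the box condition already implies nonnegativity, so the set is the
  hull cut with an open box, hence relatively open.\<close>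

lemma weight_nbhd_simplex_interior:
  "{v \<in> prob_simplex m. \<forall>l<m. \<bar>v l - ws l\<bar> < ws l / 2} \<subseteq> simplex_interior m"
    (is "?V \<subseteq> _")
proof -
  let ?H = "{v \<in> rvecs m. (\<Sum>l<m. v l) = 1}"
  \<comment> \<open>The strict inequality forces \<open>ws l > 0\<close>, and then
    \<open>v l > ws l / 2\<close>.\<close>
  have "0 \<le> v l" if "\<bar>v l - ws l\<bar> < ws l / 2" for v :: "nat \<Rightarrow> real" and l
    using that by linarith
  then have V: "?V = ?H \<inter> {v. \<forall>l<m. \<bar>v l - ws l\<bar> < ws l / 2}"
    unfolding prob_simplex_def by blast
  have "openin (top_of_set ?H) ?V"
    unfolding V by (rule openin_open_Int[OF open_weight_nbhd])
  then show ?thesis unfolding simplex_interior_def by (intro interior_of_maximal) auto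
qed

theorem corollaryC1:
  "\<exists>C0::real. C0 > 0 \<and>
    (\<forall>(d::nat) (n::nat) (m::nat) (\<mu>s :: nat \<Rightarrow> nat \<Rightarrow> real) (ws :: nat \<Rightarrow> real)
       (lmax::real) (lmin::real) (Dmax::real) (Dmin::real)
       (S :: nat \<Rightarrow> nat set) (\<mu>t :: nat \<Rightarrow> nat \<Rightarrow> real) (U :: (nat \<Rightarrow> nat \<Rightarrow> real) set).
       teacher C0 d n m \<mu>s ws lmax lmin Dmax Dmin \<longrightarrow>
       index_partition n m S \<longrightarrow>
       \<mu>t \<in> configs d n \<longrightarrow>
       (\<forall>l<m. \<forall>i\<in>S l. \<mu>t i = \<mu>s l) \<longrightarrow>
       U \<subseteq> configs d n \<longrightarrow>
       compact U \<longrightarrow>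
       \<mu>t \<in> (top_of_set (configs d n)) interior_of U \<longrightarrow>
       (\<forall>\<mu>\<in>U. \<forall>l<m. \<forall>i\<in>S l. \<forall>j<m. edist d (\<mu> i) (\<mu>s l) \<le> edist d (\<mu> i) (\<mu>s j)) \<longrightarrow>
       min_loss d n m \<mu>s ws = 0 \<and>
       (\<exists>V Cfloor.
          V \<subseteq> simplex_interior m \<and>
          ws \<in> (top_of_set (prob_simplex m)) interior_of V \<and>
          Cfloor > 0 \<and>
          (\<forall>w\<in>prob_simplex n. group_weights m S w \<in> V \<longrightarrow>
             loss_dagger d n m \<mu>s ws U w - min_loss d n m \<mu>s ws \<le> Cfloor * (weight_dev m ws S w)\<^sup>2)))"
proof (intro exI[of _ 1] conjI allI impI)
  fix d n m :: nat and \<mu>s :: "nat \<Rightarrow> nat \<Rightarrow> real" and ws :: "nat \<Rightarrow> real"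
    and lmax lmin Dmax Dmin :: real and S \<mu>t and U :: "(nat \<Rightarrow> nat \<Rightarrow> real) set"
  assume T: "teacher 1 d n m \<mu>s ws lmax lmin Dmax Dmin"
    and S: "index_partition n m S"
    and \<mu>t: "\<mu>t \<in> configs d n" "\<forall>l<m. \<forall>i\<in>S l. \<mu>t i = \<mu>s l"
    and U: "compact U" "\<mu>t \<in> (top_of_set (configs d n)) interior_of U"
  have ws: "ws \<in> prob_simplex m" and ws_pos: "\<And>l. l < m \<Longrightarrow> ws l > 0"
    using T by (auto simp: teacher_def)
  \<comment> \<open>For \<open>m = 0\<close> the weights would sum to 0 instead of 1. Positivity of
    \<open>m\<close> makes the set under \<open>Max\<close> in \<open>weight_dev\<close>
    nonempty.\<close>
  have "m > 0" using ws by (cases m) (auto simp: prob_simplex_def)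
  show min0: "min_loss d n m \<mu>s ws = 0" by (rule min_loss_eq_0[OF S ws \<mu>t])
  \<comment> \<open>The radius \<open>ws l / 2\<close> keeps every relative weight error below
    \<open>1/2\<close>, the range required by \<open>loss_le_of_rel_dev\<close>.\<close>
  define V where "V = {v \<in> prob_simplex m. \<forall>l<m. \<bar>v l - ws l\<bar> < ws l / 2}"
  have "V = prob_simplex m \<inter> {v. \<forall>l<m. \<bar>v l - ws l\<bar> < ws l / 2}" by (auto simp: V_def)
  then have "openin (top_of_set (prob_simplex m)) V"
    using openin_open_Int[OF open_weight_nbhd] by (simp only:)
  then have "V \<subseteq> (top_of_set (prob_simplex m)) interior_of V"
    by (intro interior_of_maximal) auto
  moreover have "ws \<in> V" using ws ws_pos by (simp add: V_def)
  ultimately have V_int: "ws \<in> (top_of_set (prob_simplex m)) interior_of V" by blast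
  have "loss_dagger d n m \<mu>s ws U w \<le> 2 * (weight_dev m ws S w)\<^sup>2"
    if w: "w \<in> prob_simplex n" and V: "group_weights m S w \<in> V" for w
  proof -
    let ?g = "group_weights m S w" and ?\<delta> = "weight_dev m ws S w"
    have ne: "finite ((\<lambda>l. \<bar>?g l - ws l\<bar> / ws l) ` {..<m})" "(\<lambda>l. \<bar>?g l - ws l\<bar> / ws l) ` {..<m} \<noteq> {}"
      using \<open>m > 0\<close> by auto
    have dev: "\<bar>?g l - ws l\<bar> \<le> ?\<delta> * ws l" if "l < m" for l
    proof -
      have "\<bar>?g l - ws l\<bar> / ws l \<le> ?\<delta>"
        unfolding weight_dev_def using that by (intro Max_ge ne) auto
      then show ?thesis using ws_pos[OF that] by (simp add: divide_simps)
    qed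
    have "?\<delta> \<le> 1/2"
      unfolding weight_dev_def using ne
    proof (rule Max.boundedI)
      fix y assume "y \<in> (\<lambda>l. \<bar>?g l - ws l\<bar> / ws l) ` {..<m}"
      then obtain l where l: "l < m" "y = \<bar>?g l - ws l\<bar> / ws l" by auto
      have "\<bar>?g l - ws l\<bar> < ws l / 2" using V l(1) by (simp add: V_def)
      then show "y \<le> 1/2" using ws_pos[OF l(1)] by (simp add: l(2) pos_divide_le_eq)
    qed
    \<comment> \<open>Read off from \<open>dev\<close> at index 0, where the weight is
      positive.\<close>
    moreover have "0 \<le> ?\<delta>"
      using dev[OF \<open>m > 0\<close>] ws_pos[OF \<open>m > 0\<close>] abs_ge_zero[of "?g 0 - ws 0"]
      by (metis order_trans zero_le_mult_iff not_le)
    \<comment> \<open>Each weight error is at most \<open>?\<delta> * ws l\<close>. Gaussians are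
      positive, so the triangle inequality carries the relative bound from weights to densities with
      the same constant.\<close>
    moreover have "\<bar>mixture d n \<mu>t w x - mixture d m \<mu>s ws x\<bar> \<le> ?\<delta> * mixture d m \<mu>s ws x" for x
    proof -
      have "mixture d n \<mu>t w x - mixture d m \<mu>s ws x = (\<Sum>l<m. (?g l - ws l) * gauss d (\<mu>s l) x)"
        unfolding mixture_grouped[OF S \<mu>t(2)] by (simp add: mixture_def sum_subtractf left_diff_distrib)
      also have "\<bar>\<dots>\<bar> \<le> (\<Sum>l<m. \<bar>(?g l - ws l) * gauss d (\<mu>s l) x\<bar>)"
        by (rule sum_abs)
      also have "\<dots> \<le> (\<Sum>l<m. ?\<delta> * ws l * gauss d (\<mu>s l) x)"
        using dev
        by (intro sum_mono) (simp add: abs_mult abs_of_pos[OF gauss_pos] mult_right_mono less_imp_le[OF gauss_pos])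
      also have "\<dots> = ?\<delta> * mixture d m \<mu>s ws x"
        by (simp add: mixture_def sum_distrib_left mult.assoc)
      finally show ?thesis .
    qed
    ultimately have "loss d n m \<mu>s ws \<mu>t w \<le> 2 * ?\<delta>\<^sup>2"
      by (intro loss_le_of_rel_dev[OF ws w]) auto
    moreover have "\<mu>t \<in> U" by (rule subsetD[OF interior_of_subset U(2)])
    ultimately show ?thesis
      by (intro order_trans[OF loss_dagger_le[OF U(1) ws w]])
  qed
  then have "\<forall>w\<in>prob_simplex n. group_weights m S w \<in> V \<longrightarrow>
      loss_dagger d n m \<mu>s ws U w - min_loss d n m \<mu>s ws \<le> 2 * (weight_dev m ws S w)\<^sup>2"
    by (simp add: min0)
  moreover have "V \<subseteq> simplex_interior m"
    unfolding V_def by (rule weight_nbhd_simplex_interior)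
  ultimately show "\<exists>V Cfloor. V \<subseteq> simplex_interior m \<and>
      ws \<in> (top_of_set (prob_simplex m)) interior_of V \<and> Cfloor > 0 \<and>
      (\<forall>w\<in>prob_simplex n. group_weights m S w \<in> V \<longrightarrow>
        loss_dagger d n m \<mu>s ws U w - min_loss d n m \<mu>s ws \<le> Cfloor * (weight_dev m ws S w)\<^sup>2)"
    using V_int by (intro exI[of _ V] exI[of _ 2]) auto
qed simp

end
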